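(* Let $k\ge 1$ and let $\mathscr{H}^{(1)},\dots,\mathscr{H}^{(k)}$ be finite-dimensional complex Hilbert spaces, all of the same dimension $n$, and let $\mathscr{H}^{(1\div k)}=\bigotimes_{i=1}^k\mathscr{H}^{(i)}$. Let $a\in\mathcal{H}(\mathscr{H}^{(1\div k)})$ be a Hermitian operator and let $\mathcal{I}_a=\{x\in\mathcal{H}(\mathscr{H}^{(1\div k)}):(x,a)=0\}$ be its corresponding hyperplane. If $a$ is an entanglement witness, then for every $p\in\mathfrak{P}^{(1\div k)}\cap\mathcal{I}_a$ one has $\mathfrak{C}(p)\subseteq\mathcal{I}_a$.
   Context: For a finite-dimensional complex Hilbert space $\mathscr{H}$, $\mathcal{H}(\mathscr{H})$ is the real vector space of Hermitian operators on $\mathscr{H}$, with inner product $(x,y)=\mathrm{Tr}(x^\dagger y)=\mathrm{Tr}(xy)$. $\mathcal{S}(\mathscr{H})$, the set of states, consists of the positive (semidefinite) operators of trace one. On $\mathscr{H}^{(1\div k)}=\bigotimes_{i=1}^k\mathscr{H}^{(i)}$: - $\mathfrak{P}^{(1\div k)}$ is the set of pure product states, i.e. operators $\bigotimes_{j=1}^k|e^{(j)}\rangle\langle e^{(j)}|$ with $|e^{(j)}\rangle\in\mathscr{H}^{(j)}$ and $\langle e^{(j)}|e^{(j)}\rangle=1$ for all $j$. - A state $\varrho\in\mathcal{S}(\mathscr{H}^{(1\div k)})$ is separable if $\varrho=\sum_i p_i\bigotimes_{j=1}^k\varrho_i^{(j)}$ (a finite sum) with $p_i\ge0$, $\sum_i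 p_i=1$, $\varrho_i^{(j)}\in\mathcal{S}(\mathscr{H}^{(j)})$. The set of separable states is $\mathfrak{S}^{(1\div k)}$; it is the convex hull of $\mathfrak{P}^{(1\div k)}$. The set of entangled states is $\mathfrak{E}^{(1\div k)}=\mathcal{S}(\mathscr{H}^{(1\div k)})\setminus\mathfrak{S}^{(1\div k)}$. - $a\in\mathcal{H}(\mathscr{H}^{(1\div k)})$ is an entanglement witness if $(a,p)\ge0$ for all $p\in\mathfrak{S}^{(1\div k)}$ and there is at least one $q\in\mathfrak{E}^{(1\div k)}$ with $(a,q)<0$. - For $i=1,\dots,k$, $\tau^{(i)}$ is the real span of the operators $\mathbb{I}\otimes\cdots\otimes\mathbb{I}\otimes h^{(i)}\otimes\mathbb{I}\otimes\cdots\otimes\mathbb{I}$ with $h^{(i)}\in\mathcal{H}(\mathscr{H}^{(i)})$ in the $i$-th tensor factor, $\mathrm{Tr}\,h^{(i)}=0$, and identities in the other factors. $\tau$ is the real span of $\bigcup_{i=1}^k\tau^{(i)}$ (that is, $\tau=\bigoplus_{i=1}^k\tau^{(i)}$). - For $p\in\mathcal{H}(\mathscr{H}^{(1\div k)})$, $\mathfrak{C}(p)=\{\mathrm{i}[p,t]:t\in\tau\}$, where $\mathrm{i}$ is the imaginary unit and $[p,t]=pt-tp$; this is a real subspace of $\mathcal{H}(\mathscr{H}^{(1\div k)})$. *)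

theory Defs
  imports "HOL-Analysis.Analysis"
begin

text \<open>
  A Hilbert space of dimension \<open>n\<close> is coordinatised by an orthonormal basis as \<^typ>\<open>complex^'n\<close>
  with \<open>n = CARD('n)\<close>, and its operators are matrices. The \<open>k = CARD('k)\<close> tensor factors are
  indexed by \<^typ>\<open>'k\<close>. The product vectors \<open>\<Otimes>\<^sub>j |f j\<rangle>\<close>, for
  \<^typ>\<open>'k \<Rightarrow> 'n\<close> multi-indices \<open>f\<close>, form an orthonormal basis of the tensor product,
  so operators on it are matrices over these multi-indices.
\<close>

type_synonym 'n cmatrix = "complex^'n^'n"

definition dagger :: "'n::finite cmatrix \<Rightarrow> 'n cmatrix" where
  "dagger A = (\<chi> i j. cnj (A $ j $ i))"

definition hermitian :: "('n::finite cmatrix) set" where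
  "hermitian = {A. dagger A = A}"

definition cinner :: "complex^'n::finite \<Rightarrow> complex^'n \<Rightarrow> complex" where
  "cinner u v = (\<Sum>i\<in>UNIV. cnj (u $ i) * v $ i)"

text \<open>The real part discards nothing on Hermitian matrices: see \<open>hs_inner_hermitian\<close> below.\<close>

definition hs_inner :: "'n::finite cmatrix \<Rightarrow> 'n cmatrix \<Rightarrow> real" where
  "hs_inner x y = Re (trace (dagger x ** y))"

lemma cnj_trace: "cnj (trace A) = trace (dagger A)"
  by (simp add: trace_def dagger_def)

lemma dagger_mult: "dagger (A ** B) = dagger B ** dagger A"
proof -
  have "cnj (\<Sum>k\<in>UNIV. A $ j $ k * B $ k $ i) = (\<Sum>k\<in>UNIV. cnj (B $ k $ i) * cnj (A $ j $ k))" for i j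
    unfolding cnj_sum complex_cnj_mult by (rule sum.cong[OF refl]) (rule mult.commute)
  then show ?thesis
    unfolding dagger_def matrix_matrix_mult_def by simp
qed

lemma hs_inner_hermitian:
  assumes "x \<in> hermitian" "y \<in> hermitian"
  shows "complex_of_real (hs_inner x y) = trace (x ** y)"
proof -
  have d: "dagger x = x" "dagger y = y"
    using assms unfolding hermitian_def by auto
  have "cnj (trace (x ** y)) = trace (y ** x)"
    unfolding cnj_trace dagger_mult d ..
  also have "\<dots> = trace (x ** y)"
    by (rule trace_mul_sym)
  finally have "trace (x ** y) \<in> \<real>"
    by (simp only: Reals_cnj_iff)
  then show ?thesis
    unfolding hs_inner_def d by (rule of_real_Re)
qed

definition positive_operator :: "'n::finite cmatrix \<Rightarrow> bool" where
  "positive_operator A \<longleftrightarrow> A \<in> hermitian \<and> (\<forall>v. 0 \<le> Re (cinner v (A *v v)))"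

definition states :: "('n::finite cmatrix) set" where
  "states = {\<rho>. positive_operator \<rho> \<and> trace \<rho> = 1}"

definition tensor_op :: "('k::finite \<Rightarrow> 'n::finite cmatrix) \<Rightarrow> ('k \<Rightarrow> 'n) cmatrix" where
  "tensor_op A = (\<chi> f g. \<Prod>j\<in>UNIV. A j $ f j $ g j)"

definition ketbra :: "complex^'n::finite \<Rightarrow> 'n cmatrix" where
  "ketbra e = (\<chi> i j. e $ i * cnj (e $ j))"

definition pure_product_states :: "(('k::finite \<Rightarrow> 'n::finite) cmatrix) set" where
  "pure_product_states = {tensor_op (\<lambda>j. ketbra (e j)) | e. \<forall>j. cinner (e j) (e j) = 1}"

definition separable_states :: "(('k::finite \<Rightarrow> 'n::finite) cmatrix) set" where
  "separable_states = {\<rho> \<in> states. \<exists>(N::nat) (p :: nat \<Rightarrow> real) (r :: nat \<Rightarrow> 'k \<Rightarrow> 'n cmatrix).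
     (\<forall>i<N. 0 \<le> p i) \<and> (\<Sum>i<N. p i) = 1 \<and> (\<forall>i<N. \<forall>j. r i j \<in> states) \<and>
     \<rho> = (\<Sum>i<N. p i *\<^sub>R tensor_op (r i))}"

definition entangled_states :: "(('k::finite \<Rightarrow> 'n::finite) cmatrix) set" where
  "entangled_states = states - separable_states"

definition entanglement_witness :: "('k::finite \<Rightarrow> 'n::finite) cmatrix \<Rightarrow> bool" where
  "entanglement_witness a \<longleftrightarrow> a \<in> hermitian \<and>
     (\<forall>p\<in>separable_states. 0 \<le> hs_inner a p) \<and> (\<exists>q\<in>entangled_states. hs_inner a q < 0)"

definition local_tau :: "'k::finite \<Rightarrow> (('k \<Rightarrow> 'n::finite) cmatrix) set" where
  "local_tau i = span {tensor_op (\<lambda>j. if j = i then h else mat 1) | h. h \<in> hermitian \<and> trace h = 0}"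

definition tau :: "(('k::finite \<Rightarrow> 'n::finite) cmatrix) set" where
  "tau = span (\<Union>i. local_tau i)"

definition cscale :: "complex \<Rightarrow> 'n::finite cmatrix \<Rightarrow> 'n cmatrix" where
  "cscale c A = (\<chi> i j. c * A $ i $ j)"

definition commutator :: "'n::finite cmatrix \<Rightarrow> 'n cmatrix \<Rightarrow> 'n cmatrix" where
  "commutator p t = p ** t - t ** p"

definition commutator_space :: "('k::finite \<Rightarrow> 'n::finite) cmatrix \<Rightarrow> (('k \<Rightarrow> 'n) cmatrix) set" where
  "commutator_space p = {cscale \<i> (commutator p t) | t. t \<in> tau}"

definition hyperplane :: "'n::finite cmatrix \<Rightarrow> ('n cmatrix) set" where
  "hyperplane a = {x \<in> hermitian. hs_inner x a = 0}"

end

(* Replace one factor e of a product vector annihilated by a with e + s (i h e), for real s.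
   The expectation of a in the resulting (unnormalised) product vector is a nonnegative real
   quadratic polynomial in s without constant term, so its linear coefficient vanishes. That
   coefficient is, up to sign, the inner product of a with i[p, t], where t is the local
   operator given by h. Working with e + s (i h e) rather than exp (i s h) e avoids the matrix
   exponential. *)
theory Submission imports Defs begin

lemma hermitian_iff: "A \<in> hermitian \<longleftrightarrow> (\<forall>i j. cnj (A $ j $ i) = A $ i $ j)"
  by (auto simp: hermitian_def dagger_def vec_eq_iff)

text \<open>Swapping the arguments conjugates the trace, and \<open>hs_inner\<close> keeps only its
  real part. This covers arbitrary matrices, Hermitian or not.\<close>

lemma hs_inner_commute: "hs_inner x y = hs_inner y x"
proof -
  have "dagger (dagger x ** y) = dagger y ** x"
    by (simp only: dagger_mult) (simp add: dagger_def vec_eq_iff)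
  then have "cnj (trace (dagger x ** y)) = trace (dagger y ** x)"
    by (simp only: cnj_trace)
  then show ?thesis
    unfolding hs_inner_def by (metis complex_cnj(1) complex.sel(1) complex.collapse)
qed

lemma linear_hs_inner: "linear (hs_inner a)"
  by (rule linearI)
    (simp_all add: hs_inner_def trace_def matrix_matrix_mult_def algebra_simps
      sum.distrib scaleR_sum_right sum_distrib_left)

text \<open>Distributivity: choosing a multi-index \<open>f\<close> means choosing one summand from
  each factor. Read from right to left, it yields products and traces of tensor operators factor by
  factor.\<close>

lemma sum_fun_prod:
  fixes F :: "'k::finite \<Rightarrow> 'n::finite \<Rightarrow> 'a::comm_semiring_1"
  shows "(\<Sum>f\<in>UNIV. \<Prod>j\<in>UNIV. F j (f j)) = (\<Prod>j\<in>UNIV. \<Sum>x\<in>UNIV. F j x)"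
  by (subst prod_sum_PiE) (simp_all add: PiE_UNIV_domain)

lemma tensor_op_mult: "tensor_op A ** tensor_op B = tensor_op (\<lambda>j. A j ** B j)"
  by (simp add: tensor_op_def matrix_matrix_mult_def vec_eq_iff
      flip: prod.distrib sum_fun_prod)

lemma trace_tensor_op: "trace (tensor_op A) = (\<Prod>j\<in>UNIV. trace (A j))"
  by (simp add: trace_def tensor_op_def flip: sum_fun_prod)

lemma tensor_op_hermitian: "(\<And>j. A j \<in> hermitian) \<Longrightarrow> tensor_op A \<in> hermitian"
  by (simp add: hermitian_iff tensor_op_def)

lemma mat_1_hermitian: "mat 1 \<in> hermitian"
  by (simp add: hermitian_iff mat_def)

text \<open>Multilinearity in one slot: each entry of the tensor operator contains exactly one entry
  of \<open>X\<close>, times a product that does not involve \<open>X\<close>.\<close>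

lemma linear_tensor_op_upd:
  fixes E :: "'k::finite \<Rightarrow> 'n::finite cmatrix"
  shows "linear (\<lambda>X. tensor_op (E(i := X)))"
proof -
  have "tensor_op (E(i := X)) $ f $ g = X $ f i $ g i * (\<Prod>j\<in>UNIV - {i}. E j $ f j $ g j)"
    for X f g
    by (simp add: tensor_op_def prod.remove[of UNIV i])
  then show ?thesis
    by (intro linearI) (simp_all add: vec_eq_iff distrib_right)
qed

text \<open>Complements the previous lemma, since \<open>linear\<close> covers real scalars only and
  the factor \<i> has to be moved into a slot.\<close>

lemma cscale_tensor_op:
  fixes E :: "'k::finite \<Rightarrow> 'n::finite cmatrix"
  shows "cscale c (tensor_op (E(i := X))) = tensor_op (E(i := cscale c X))"
  by (simp add: tensor_op_def cscale_def vec_eq_iff prod.remove[of UNIV i] mult.assoc)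

lemma ketbra_hermitian: "ketbra e \<in> hermitian"
  by (simp add: hermitian_iff ketbra_def)

lemma ketbra_scaleR: "ketbra (r *\<^sub>R v) = r\<^sup>2 *\<^sub>R ketbra v"
  by (simp add: ketbra_def vec_eq_iff power2_eq_square)

lemma trace_ketbra: "trace (ketbra e) = cinner e e"
  by (simp add: trace_def ketbra_def cinner_def mult.commute)

text \<open>The quadratic form at \<open>v\<close> is the squared modulus of
  \<open>cinner e v\<close>.\<close>

lemma ketbra_positive: "positive_operator (ketbra e)"
proof -
  have "cinner v (ketbra e *v v) = cnj (cinner e v) * cinner e v" for v
    unfolding cinner_def cnj_sum sum_product
    by (simp add: ketbra_def matrix_vector_mult_def sum_distrib_left mult_ac)
  then show ?thesis
    by (simp add: positive_operator_def ketbra_hermitian)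
qed

text \<open>Makes a product of rank-one projections itself a \<open>ketbra\<close>, so that its
  positivity is an instance of \<open>ketbra_positive\<close>.\<close>

lemma tensor_op_ketbra: "tensor_op (\<lambda>j. ketbra (e j)) = ketbra (\<chi> f. \<Prod>j\<in>UNIV. e j $ f j)"
  by (simp add: tensor_op_def ketbra_def vec_eq_iff prod.distrib)

lemma cinner_self: "cinner v v = of_real ((norm v)\<^sup>2)"
proof -
  have "(norm v)\<^sup>2 = (\<Sum>i\<in>UNIV. (norm (v $ i))\<^sup>2)"
    by (simp add: norm_vec_def L2_set_def sum_nonneg)
  then show ?thesis
    by (simp only: cinner_def of_real_sum complex_norm_square mult.commute)
qed

lemma pure_product_states_separable: "pure_product_states \<subseteq> separable_states"
proof
  fix p :: "('k::finite \<Rightarrow> 'n::finite) cmatrix"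
  assume "p \<in> pure_product_states"
  then obtain e :: "'k \<Rightarrow> complex^'n" where p: "p = tensor_op (\<lambda>j. ketbra (e j))"
    and e: "\<And>j. cinner (e j) (e j) = 1"
    by (auto simp: pure_product_states_def)
  have "ketbra (e j) \<in> states" for j
    by (simp add: states_def ketbra_positive trace_ketbra e)
  moreover have "p \<in> states"
    using e by (simp add: p states_def trace_tensor_op trace_ketbra)
      (simp add: tensor_op_ketbra ketbra_positive)
  ultimately show "p \<in> separable_states"
    unfolding separable_states_def
    \<comment> \<open>A convex combination with a single term of weight 1.\<close>
    by (intro CollectI conjI exI[of _ 1] exI[of _ "\<lambda>_. 1"] exI[of _ "\<lambda>_ j. ketbra (e j)"])
      (auto simp: p)
qed

text \<open>The witness condition concerns unit vectors only. It extends to an arbitrary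
  \<open>v\<close> in slot \<open>i\<close> because \<open>ketbra\<close> is homogeneous of degree 2
  and the slot is linear.\<close>

lemma hs_inner_product_vector_nonneg:
  fixes a :: "('k::finite \<Rightarrow> 'n::finite) cmatrix"
  assumes a: "entanglement_witness a" and e: "\<And>j. cinner (e j) (e j) = 1"
  shows "0 \<le> hs_inner a (tensor_op ((\<lambda>j. ketbra (e j))(i := ketbra v)))"
proof -
  interpret L: linear "\<lambda>X. hs_inner a (tensor_op ((\<lambda>j. ketbra (e j))(i := X)))"
    using linear_compose[OF linear_tensor_op_upd linear_hs_inner] by (simp add: o_def)
  show ?thesis
  proof (cases "v = 0")
    case True
    then show ?thesis
      \<comment> \<open>Scaling by 0 shows that \<open>ketbra 0\<close> vanishes.\<close>
      using ketbra_scaleR[of 0 v] L.zero by simp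
  next
    case False
    define u where "u = (1 / norm v) *\<^sub>R v"
    have v: "v = norm v *\<^sub>R u" and "cinner u u = 1"
      using False by (simp_all add: u_def cinner_self)
    then have "tensor_op (\<lambda>j. ketbra ((e(i := u)) j)) \<in> pure_product_states"
      using e unfolding pure_product_states_def by fastforce
    moreover have "(\<lambda>j. ketbra ((e(i := u)) j)) = (\<lambda>j. ketbra (e j))(i := ketbra u)"
      by auto
    ultimately have "0 \<le> hs_inner a (tensor_op ((\<lambda>j. ketbra (e j))(i := ketbra u)))"
      using a pure_product_states_separable unfolding entanglement_witness_def by auto
    then show ?thesis
      by (subst v) (simp only: ketbra_scaleR L.scale, simp)
  qed
qed

text \<open>Expand the outer product. Since \<open>h\<close> is Hermitian, the bra of
  \<open>h *v e\<close> is the bra of \<open>e\<close> times \<open>h\<close>, so the two cross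
  terms combine into a commutator.\<close>

lemma ketbra_perturb:
  assumes h: "h \<in> hermitian"
  shows "ketbra (e + s *\<^sub>R (\<chi> j. \<i> * (h *v e) $ j)) =
    ketbra e + s *\<^sub>R cscale (-\<i>) (commutator (ketbra e) h) + s\<^sup>2 *\<^sub>R ketbra (h *v e)"
proof -
  have "(ketbra e ** h) $ x $ y = e $ x * cnj ((h *v e) $ y)" for x y
  proof -
    have "h $ k $ y = cnj (h $ y $ k)" for k
      using h by (simp add: hermitian_iff)
    then show ?thesis
      by (simp add: ketbra_def matrix_matrix_mult_def matrix_vector_mult_def
          sum_distrib_left mult_ac)
  qed
  moreover have "(h ** ketbra e) $ x $ y = (h *v e) $ x * cnj (e $ y)" for x y
    by (simp add: ketbra_def matrix_matrix_mult_def matrix_vector_mult_def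
        sum_distrib_left mult_ac)
  ultimately show ?thesis
    by (simp add: vec_eq_iff cscale_def commutator_def)
      (simp add: ketbra_def algebra_simps power2_eq_square
        scaleR_conv_of_real[where 'a = complex])
qed

lemma linear_coeff_zero_if_quadratic_nonneg:
  fixes D C :: real
  assumes "\<And>s. 0 \<le> s * D + s\<^sup>2 * C"
  shows "D = 0"
proof (rule ccontr)
  assume D: "D \<noteq> 0"
  \<comment> \<open>Any positive \<open>m\<close> above \<open>C\<close> would do: at
    \<open>s = - D / m\<close> the quadratic equals
    \<open>- D\<^sup>2 * (m - C) / m\<^sup>2\<close>, which is negative.\<close>
  define m where "m = \<bar>C\<bar> + 1"
  have m: "m > 0" "C < m"
    by (auto simp: m_def)
  have "(- D / m) * D + (- D / m)\<^sup>2 * C = - (D\<^sup>2 * (m - C)) / m\<^sup>2"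
    using m by (simp add: field_simps power2_eq_square)
  also have "\<dots> < 0"
    using m D by (simp add: field_simps)
  finally show False
    using assms[of "- D / m"] by simp
qed

lemma linear_cscale_commutator: "linear (\<lambda>t. cscale c (commutator p t))"
  by (rule linearI)
    (simp_all add: vec_eq_iff cscale_def commutator_def matrix_matrix_mult_def algebra_simps
      sum.distrib flip: scaleR_sum_right)

text \<open>Taking adjoints reverses the sign of the commutator, and conjugating \<i> reverses it
  again.\<close>

lemma commutator_hermitian:
  assumes "p \<in> hermitian" "t \<in> hermitian"
  shows "cscale \<i> (commutator p t) \<in> hermitian"
proof -
  have "dagger (p ** t) = t ** p" "dagger (t ** p) = p ** t"
    using assms by (simp_all add: dagger_mult hermitian_def)
  then show ?thesis
    by (simp add: hermitian_iff cscale_def commutator_def dagger_def vec_eq_iff algebra_simps)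
qed

lemma subspace_hyperplane: "subspace (hyperplane a)"
proof -
  interpret linear "hs_inner a" by (rule linear_hs_inner)
  show ?thesis
    by (rule subspaceI)
      (auto simp: hyperplane_def hermitian_iff hs_inner_commute[of _ a] zero add scale)
qed

lemma commutator_local_in_hyperplane:
  fixes a :: "('k::finite \<Rightarrow> 'n::finite) cmatrix"
  assumes a: "entanglement_witness a" and p: "p \<in> pure_product_states \<inter> hyperplane a"
    and h: "h \<in> hermitian"
  shows "cscale \<i> (commutator p (tensor_op (\<lambda>j. if j = i then h else mat 1))) \<in> hyperplane a"
    (is "cscale \<i> (commutator p ?t) \<in> _")
proof -
  obtain e :: "'k \<Rightarrow> complex^'n" where pe: "p = tensor_op (\<lambda>j. ketbra (e j))"
    and e: "\<And>j. cinner (e j) (e j) = 1"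
    using p by (auto simp: pure_product_states_def)
  let ?T = "\<lambda>X. tensor_op ((\<lambda>j. ketbra (e j))(i := X))"
  interpret T: linear ?T
    by (rule linear_tensor_op_upd)
  interpret L: linear "\<lambda>X. hs_inner a (?T X)"
    using linear_compose[OF linear_tensor_op_upd linear_hs_inner] by (simp add: o_def)
  \<comment> \<open>Filling slot \<open>i\<close> with its own projection gives back
    \<open>p\<close>, which lies in the hyperplane; hence the quadratic in \<open>s\<close> has no
    constant term.\<close>
  have L0: "hs_inner a (?T (ketbra (e i))) = 0"
    using p by (simp add: hyperplane_def pe hs_inner_commute fun_upd_idem)
  have "0 \<le> s * hs_inner a (?T (cscale (-\<i>) (commutator (ketbra (e i)) h)))
      + s\<^sup>2 * hs_inner a (?T (ketbra (h *v e i)))" for s :: real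
  proof -
    have "0 \<le> hs_inner a (?T (ketbra (e i + s *\<^sub>R (\<chi> j. \<i> * (h *v e i) $ j))))"
      by (rule hs_inner_product_vector_nonneg[OF a e])
    then show ?thesis
      by (simp only: ketbra_perturb[OF h] L.add L.scale L0) simp
  qed
  then have "hs_inner a (?T (cscale (-\<i>) (commutator (ketbra (e i)) h))) = 0"
    by (rule linear_coeff_zero_if_quadratic_nonneg)
  moreover have "cscale (-\<i>) X = - cscale \<i> X" for X :: "'n cmatrix"
    by (simp add: cscale_def vec_eq_iff)
  ultimately have 0: "hs_inner a (?T (cscale \<i> (commutator (ketbra (e i)) h))) = 0"
    by (simp only: L.neg neg_equal_0_iff_equal)
  \<comment> \<open>In every slot other than \<open>i\<close> the identity leaves
    \<open>ketbra (e j)\<close> unchanged on either side, so the commutator is taken in slot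
    \<open>i\<close> alone.\<close>
  have "p ** ?t = ?T (ketbra (e i) ** h)" "?t ** p = ?T (h ** ketbra (e i))"
    unfolding pe tensor_op_mult by (rule arg_cong[where f = tensor_op], auto)+
  then have "commutator p ?t = ?T (commutator (ketbra (e i)) h)"
    by (simp only: commutator_def T.diff)
  then have "hs_inner a (cscale \<i> (commutator p ?t)) = 0"
    by (simp only: cscale_tensor_op 0)
  moreover have "cscale \<i> (commutator p ?t) \<in> hermitian"
    using p h by (intro commutator_hermitian tensor_op_hermitian)
      (auto simp: hyperplane_def mat_1_hermitian)
  ultimately show ?thesis
    by (simp add: hyperplane_def hs_inner_commute)
qed

theorem mainTheorem2:
  fixes a :: "('k::finite \<Rightarrow> 'n::finite) cmatrix"
  assumes "a \<in> hermitian"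
    and "entanglement_witness a"
  shows "\<forall>p \<in> pure_product_states \<inter> hyperplane a. commutator_space p \<subseteq> hyperplane a"
proof
  fix p assume p: "p \<in> pure_product_states \<inter> hyperplane a"
  \<comment> \<open>The preimage of a subspace under a linear map is a subspace. It therefore
    absorbs both nested spans in \<open>tau\<close> once it contains the local generators.\<close>
  let ?V = "{t. cscale \<i> (commutator p t) \<in> hyperplane a}"
  have V: "subspace ?V"
    using linear_subspace_vimage[OF linear_cscale_commutator subspace_hyperplane]
    by (simp add: vimage_def)
  have "local_tau i \<subseteq> ?V" for i
    unfolding local_tau_def
    by (rule span_minimal[OF _ V]) (use commutator_local_in_hyperplane[OF assms(2) p] in blast)
  then have "tau \<subseteq> ?V"
    unfolding tau_def by (intro span_minimal[OF _ V]) blast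
  then show "commutator_space p \<subseteq> hyperplane a"
    by (auto simp: commutator_space_def)
qed

end
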